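(* For every integer $k$ with $4 \leq k \leq 15$, \[ p(k) > \frac{1}{4}\left(1 - \frac{1}{k}\right). \]
   Context: All infinite graphs here are simple graphs $G$ with vertex set $V(G) = \mathbb{N} = \{1,2,3,\dots\}$. For an integer $k \ge 1$, an increasing path of length $k$ in $G$, denoted $I_k$, is a sequence of $k+1$ vertices $i_1 < i_2 < \dots < i_{k+1}$ such that $i_j$ is adjacent to $i_{j+1}$ for $1 \leq j \leq k$. The graph $G$ is $I_k$-free if it contains no increasing path of length $k$. Let $G_n$ be the subgraph of $G$ induced by $\{1,2,\dots,n\}$, let $e(G_n)$ be its number of edges, and let $p(G) = \liminf_{n \to \infty} \frac{e(G_n)}{n^2}$. For $k \ge 2$, the path Turán number of $I_k$ is $p(k) = \sup\{ p(G) : G \text{ is } I_k\text{-free}\}$. *)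

theory Defs
  imports "HOL-Library.Extended_Real" "HOL-Library.Liminf_Limsup"
begin

text \<open>
  The vertex set is always the set of positive integers, so a graph is represented by its
  edge set alone: a set of two-element sets of positive integers.
\<close>

definition vertices :: "nat set" where
  "vertices = {1..}"

definition simple_graph :: "nat set set \<Rightarrow> bool" where
  "simple_graph E \<longleftrightarrow> (\<forall>e\<in>E. e \<subseteq> vertices \<and> card e = 2)"

text \<open>The length \<open>k\<close> of a path is its number of edges. List positions start at \<open>0\<close>.\<close>

definition increasing_path :: "nat set set \<Rightarrow> nat \<Rightarrow> nat list \<Rightarrow> bool" where
  "increasing_path E k vs \<longleftrightarrow>
     length vs = k + 1 \<and> set vs \<subseteq> vertices \<and> sorted_wrt (<) vs \<and>
     (\<forall>j<k. {vs ! j, vs ! (j + 1)} \<in> E)"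

definition increasing_path_free :: "nat \<Rightarrow> nat set set \<Rightarrow> bool" where
  "increasing_path_free k E \<longleftrightarrow> \<not> (\<exists>vs. increasing_path E k vs)"

definition initial_edges :: "nat set set \<Rightarrow> nat \<Rightarrow> nat set set" where
  "initial_edges E n = {e \<in> E. e \<subseteq> {1..n}}"

text \<open>
  The limit inferior and the supremum are taken in the extended reals, where they always exist.
  Since \<open>card (initial_edges E n) \<le> n * (n - 1) / 2\<close> for simple graphs, both values
  below are finite, and hence agree with the real ones, for simple graphs and \<open>k \<ge> 1\<close>.
  The index \<open>n = 0\<close>, where the quotient is \<open>0\<close> by convention, does not
  affect the limit inferior.
\<close>

definition path_density :: "nat set set \<Rightarrow> ereal" where
  "path_density E = liminf (\<lambda>n. ereal (real (card (initial_edges E n)) / (real n)\<^sup>2))"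

definition path_turan_number :: "nat \<Rightarrow> ereal" where
  "path_turan_number k =
     (SUP E \<in> {E. simple_graph E \<and> increasing_path_free k E}. path_density E)"

end

theory Submission
  imports Defs
begin

text \<open>
  Colour the vertices with \<open>0, \<dots>, k - 1\<close> and join \<open>i < j\<close> whenever the colour increases; colours
  strictly increase along an increasing path, so none has \<open>k\<close> edges. Perfectly equidistributed
  colours give density \<open>(1 - 1 / k) / 4\<close>. The theorem holds because a suitable small deviation from
  equidistribution gains at every scale.

  To see this, write \<open>Y\<^sub>i(t)\<close> for the excess of colour \<open>i\<close> among the first \<open>t\<close> vertices over \<open>t / k\<close>.
  The first-order effect of \<open>Y\<close> on the edge count depends only on the sum of the \<open>i Y\<^sub>i\<close>,
  and the second-order effect is the integral of the sum of \<open>Y\<^sub>i dY\<^sub>j\<close> over \<open>i < j\<close>. If \<open>Y\<close> moves in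
  the space where the sums of \<open>Y\<^sub>i\<close> and of \<open>i Y\<^sub>i\<close> both vanish, the first-order effect
  disappears. The second-order effect splits into a boundary term, which is negative definite, and
  a signed area swept by \<open>Y\<close>. With four colours this space is a plane on which the area form
  does not vanish, so a path \<open>Y\<close> that circles the origin in the right direction, with
  diameter proportional to \<open>t\<close> and sufficiently often per doubling of \<open>t\<close>, collects an area
  that exceeds the boundary term at every moment and is of order \<open>t\<^sup>2\<close>.

  A discrete version of such a path is built from the words \<open>0303\<close>, \<open>1113\<close>, \<open>0222\<close>. Each has
  the average letter \<open>3 / 2\<close>, so \<open>Y\<close> stays in the plane after every complete word; each letter occurs three
  times in the three words together, so one round of the words in this order is a closed
  triangle. The \<open>m\<close>-th word is number \<open>phase m\<close>, and the self-similarity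
  \<open>phase (2 * m) = phase (Suc (2 * m)) = phase m\<close> makes the triangles twice as large each time
  \<open>m\<close> doubles. Twice the second-order effect is \<open>area m\<close>, up to a diagonal term. It satisfies an exact
  doubling law (\<open>area_double\<close>) and is concave between doubled points (\<open>area_midpoint\<close>), so its
  positivity for \<open>18 \<le> m < 36\<close> spreads to a quadratic lower bound for all larger \<open>m\<close>
  (\<open>area_lower_bound\<close>).

  More than four colours come for free: append the letters \<open>4, \<dots>, k - 1\<close> to each word. These are
  equidistributed and larger than the first four, so they leave the second-order effect unchanged
  (\<open>count_words\<close>).
\<close>

section \<open>Graphs from colourings\<close>

definition colour_graph :: "(nat \<Rightarrow> nat) \<Rightarrow> nat set set" where
  "colour_graph c = {{i, j} |i j. 1 \<le> i \<and> i < j \<and> c i < c j}"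

lemma simple_colour_graph: "simple_graph (colour_graph c)"
  unfolding simple_graph_def colour_graph_def vertices_def by auto

lemma colour_graph_edge_iff:
  assumes "i < j"
  shows "{i, j} \<in> colour_graph c \<longleftrightarrow> 1 \<le> i \<and> c i < c j"
  using assms unfolding colour_graph_def by (auto simp: doubleton_eq_iff)

lemma colour_graph_path_free:
  assumes "\<And>n. c n < k"
  shows "increasing_path_free k (colour_graph c)"
  unfolding increasing_path_free_def
proof
  assume "\<exists>vs. increasing_path (colour_graph c) k vs"
  then obtain vs where vs: "increasing_path (colour_graph c) k vs" by blast
  have "j \<le> c (vs ! j)" if "j \<le> k" for j
    using that
  proof (induction j)
    case (Suc j)
    have "vs ! j < vs ! Suc j"
      using vs Suc.prems by (auto simp: increasing_path_def sorted_wrt_iff_nth_less)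
    moreover have "{vs ! j, vs ! Suc j} \<in> colour_graph c"
      using vs Suc.prems by (auto simp: increasing_path_def)
    ultimately have "c (vs ! j) < c (vs ! Suc j)"
      by (simp add: colour_graph_edge_iff)
    then show ?case using Suc by simp
  qed simp
  from this[of k] show False using assms[of "vs ! k"] by simp
qed

section \<open>The words and their interaction\<close>

text \<open>
  The word number \<open>x\<close> is \<open>letter x 0, \<dots>, letter x (k - 1)\<close>; its length \<open>k\<close> is not
  recorded, since a longer word extends a shorter one.
\<close>

definition letter :: "nat \<Rightarrow> nat \<Rightarrow> nat" where
  "letter x p = (if p < 4 then [[0, 3, 0, 3], [1, 1, 1, 3], [0, 2, 2, 2]] ! x ! p else p)"

text \<open>
  For \<open>m \<ge> 36\<close> this halves \<open>m\<close> until it lies in \<open>{18..<36}\<close> and then cycles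
  through the three words. Thus in \<open>{18 * 2 ^ j..<36 * 2 ^ j}\<close> there are six rounds in which
  every word is repeated \<open>2 ^ j\<close> times in succession.
\<close>

fun phase :: "nat \<Rightarrow> nat" where
  "phase m = (if m < 36 then m mod 3 else phase (m div 2))"

declare phase.simps [simp del]

text \<open>
  Among the 16 pairs of positions in two words of length 4, an average of 6 is increasing when all
  four letters are equally frequent; the subtraction of 6 isolates the second-order effect.
\<close>

definition gain :: "nat \<Rightarrow> nat \<Rightarrow> int" where
  "gain x y = (\<Sum>q<4. \<Sum>p<4. of_bool (letter x p < letter y q)) - 6"

lemma phase_less: "phase m < 3"
  by (induction m rule: phase.induct) (subst phase.simps, simp)

lemma phase_cases: "phase m = 0 \<or> phase m = 1 \<or> phase m = 2"
  using phase_less[of m] by auto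

lemma phase_double:
  assumes "18 \<le> m"
  shows "phase (2 * m) = phase m" "phase (Suc (2 * m)) = phase m"
  using assms by (subst phase.simps, simp)+

text \<open>
  The rows and columns of this table sum to zero, so complete rounds of the words interact with
  nothing. Its antisymmetric part favours the cyclic order \<open>0, 1, 2\<close>, which produces the area.
\<close>

lemma gain_table:
  "gain 0 0 = -2" "gain 0 (Suc 0) = 2" "gain 0 2 = 0"
  "gain (Suc 0) 0 = 0" "gain (Suc 0) (Suc 0) = -3" "gain (Suc 0) 2 = 3"
  "gain 2 0 = 2" "gain 2 (Suc 0) = 1" "gain 2 2 = -3"
  by (simp_all add: gain_def letter_def eval_nat_numeral)

lemma letter_less:
  assumes "x < 3" "4 \<le> k" "p < k"
  shows "letter x p < k"
proof -
  have "x \<in> {0, 1, 2}" "p < 4 \<Longrightarrow> p \<in> {0, 1, 2, 3}" using assms by auto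
  then show ?thesis using assms by (auto simp: letter_def)
qed

text \<open>
  A further top letter \<open>k\<close>, placed last in both words, adds the \<open>k\<close> increasing pairs that end in it
  and no others, independently of \<open>x\<close> and \<open>y\<close>.
\<close>

lemma count_words:
  assumes "x < 3" "y < 3" "4 \<le> k"
  shows "(\<Sum>q<k. \<Sum>p<k. of_bool (letter x p < letter y q)) = int k * (int k - 1) div 2 + gain x y"
  using assms(3)
proof (induction k rule: dec_induct)
  case base
  show ?case by (simp add: gain_def)
next
  case (step k)
  have top: "letter z k = k" for z
    using step.hyps by (simp add: letter_def)
  have "letter x p < k" "letter y p < k" if "p < k" for p
    using letter_less assms step.hyps that by auto
  then have col: "(\<Sum>p<k. of_bool (letter x p < k)) = int k"
    and row: "(\<Sum>q<k. of_bool (k < letter y q)) = (0::int)"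
    by (auto intro!: sum.neutral dest: less_trans)
  have "int (Suc k) * (int (Suc k) - 1) = int k * (int k - 1) + int k * 2"
    by (simp add: algebra_simps)
  then have "int (Suc k) * (int (Suc k) - 1) div 2 = int k * (int k - 1) div 2 + int k"
    by simp
  then show ?case
    using step.IH col row by (simp add: sum.distrib top)
qed

section \<open>The second-order effect grows quadratically\<close>

definition drift :: "nat \<Rightarrow> nat \<Rightarrow> int" where
  "drift m y = (\<Sum>s<m. gain (phase s) y)"

text \<open>
  Twice the total gain over pairs of distinct words among the first \<open>m\<close>, plus the diagonal. The diagonal makes the
  doubling law free of a linear error: a word that is repeated twice forms
  one pair with its own copy, which accounts for two more diagonal terms.
\<close>

definition area :: "nat \<Rightarrow> int" where
  "area m = (\<Sum>t<m. 2 * drift t (phase t) + gain (phase t) (phase t))"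

lemma area_Suc: "area (Suc m) = area m + 2 * drift m (phase m) + gain (phase m) (phase m)"
  by (simp add: area_def)

lemma drift_Suc: "drift (Suc m) y = drift m y + gain (phase m) y"
  by (simp add: drift_def)

lemma phase_base:
  assumes "r < 12"
  shows "phase (3 * r) = 0" "phase (Suc (3 * r)) = 1" "phase (Suc (Suc (3 * r))) = 2"
  using assms by (subst phase.simps, simp, presburger?)+

lemma drift_period:
  assumes "r \<le> 12" "y < 3"
  shows "drift (3 * r) y = 0"
  using assms(1)
proof (induction r)
  case (Suc r)
  have "3 * Suc r = Suc (Suc (Suc (3 * r)))" by simp
  moreover have "y = 0 \<or> y = 1 \<or> y = 2" using assms(2) by auto
  ultimately show ?case
    using Suc phase_base[of r] by (auto simp: drift_Suc gain_table simp del: mult_Suc_right)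
qed (simp add: drift_def)

text \<open>
  A triangle that starts and ends at the origin does not see the earlier ones, so each round contributes
  the same positive amount.
\<close>

lemma area_period:
  assumes "r \<le> 12"
  shows "area (3 * r) = 2 * int r"
  using assms
proof (induction r)
  case (Suc r)
  have "3 * Suc r = Suc (Suc (Suc (3 * r)))" by simp
  then show ?case
    using Suc phase_base[of r] drift_period[of r]
    by (simp add: area_Suc drift_Suc gain_table del: mult_Suc_right)
qed (simp add: area_def)

lemma area_within_period:
  assumes "r < 12"
  shows "area (Suc (3 * r)) = 2 * int r - 2" "area (Suc (Suc (3 * r))) = 2 * int r - 1"
  using assms phase_base[of r] drift_period[of r] area_period[of r]
  by (simp_all add: area_Suc drift_Suc gain_table)

text \<open>
  Although \<open>phase\<close> is not self-similar below 18, complete rounds have been made both at 18 and at 36, so the drift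
  vanishes at both places and doubling holds from there on.
\<close>

lemma drift_double:
  assumes "18 \<le> m" "y < 3"
  shows "drift (2 * m) y = 2 * drift m y"
  using assms(1)
proof (induction m rule: dec_induct)
  case base
  show ?case using drift_period[of 6] drift_period[of 12] assms(2) by simp
next
  case (step m)
  then show ?case by (simp add: drift_Suc phase_double)
qed

text \<open>
  From \<open>2 * m\<close> to \<open>2 * m + 2\<close>, two equal words each meet twice the drift that the original word met,
  and together with their mutual gain and the diagonal the increment is exactly multiplied by four. The constant 8 is
  the fixed point determined by \<open>area 18 = 12\<close> and \<open>area 36 = 24\<close>.
\<close>

lemma area_double:
  assumes "18 \<le> m"
  shows "area (2 * m) - 8 = 4 * (area m - 8)"
  using assms
proof (induction m rule: dec_induct)
  case base
  show ?case using area_period[of 6] area_period[of 12] by simp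
next
  case (step m)
  then show ?case
    by (simp add: area_Suc drift_Suc phase_double drift_double phase_less)
qed

text \<open>
  The increments at \<open>2 * m\<close> and \<open>2 * m + 1\<close> belong to the same word and differ by twice its gain against
  itself, which is negative.
\<close>

lemma area_midpoint:
  assumes "18 \<le> m"
  shows "2 * area (Suc (2 * m)) \<ge> area (2 * m) + area (2 * Suc m)"
  using assms phase_cases[of m]
  by (auto simp: area_Suc drift_Suc phase_double gain_table)

text \<open>
  The least value of \<open>area\<close> on \<open>{18..<36}\<close> is 10, so the difference to the fixed point 8 is at least 2 there,
  and any factor of at least \<open>35\<^sup>2 / 2\<close> would do in place of 1000. Even \<open>m\<close> are reached by doubling. Odd \<open>m\<close>
  lie between two even numbers, and concavity of \<open>area\<close> is compared with convexity of the square.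
\<close>

lemma area_lower_bound:
  assumes "18 \<le> m"
  shows "1000 * (area m - 8) \<ge> int (m ^ 2)"
  using assms
proof (induction m rule: less_induct)
  case (less m)
  show ?case
  proof (cases "m < 36")
    case True
    define r where "r = m div 3"
    have r: "6 \<le> r" "r < 12" using less.prems True by (auto simp: r_def)
    have "m = 3 * r \<or> m = Suc (3 * r) \<or> m = Suc (Suc (3 * r))"
      unfolding r_def by presburger
    then have "area m \<ge> 10"
      using r area_period[of r] area_within_period[of r] by auto
    moreover have "int (m ^ 2) \<le> 36 ^ 2"
      unfolding of_nat_power using True by (intro power_mono) auto
    ultimately show ?thesis by simp
  next
    case False
    define h where "h = m div 2"
    have h: "18 \<le> h" "h < m" "m = 2 * h \<or> m = Suc (2 * h)"
      using False by (auto simp: h_def)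
    have IH: "1000 * (area h - 8) \<ge> int (h ^ 2)"
      using less.IH h by blast
    show ?thesis
    proof (cases "m = 2 * h")
      case True
      then show ?thesis using IH area_double[OF h(1)] by (simp add: power_mult_distrib)
    next
      case False
      then have m: "m = Suc (2 * h)" using h by auto
      have IH': "1000 * (area (Suc h) - 8) \<ge> int (Suc h ^ 2)"
        using less.IH[of "Suc h"] h m by simp
      have "2 * int (m ^ 2) \<le> 4 * int (h ^ 2) + 4 * int (Suc h ^ 2)"
        using m by (simp add: power2_eq_square algebra_simps)
      also have "\<dots> \<le> 1000 * (4 * (area h - 8)) + 1000 * (4 * (area (Suc h) - 8))"
        using IH IH' by linarith
      also have "\<dots> = 1000 * (area (2 * h) - 8) + 1000 * (area (2 * Suc h) - 8)"
        using area_double[of h] area_double[of "Suc h"] h(1) by (simp only: le_SucI)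
      also have "\<dots> \<le> 2 * (1000 * (area m - 8))"
        using area_midpoint[OF h(1)] unfolding m by (simp add: algebra_simps)
      finally show ?thesis by linarith
    qed
  qed
qed

section \<open>Counting edges\<close>

definition colour :: "nat \<Rightarrow> nat \<Rightarrow> nat" where
  "colour k n = letter (phase (n div k)) (n mod k)"

lemma colour_less:
  assumes "4 \<le> k"
  shows "colour k n < k"
  using assms by (simp add: colour_def letter_less phase_less)

text \<open>
  Only edges between different complete words are counted. The edges within a word and the
  incomplete last word contribute \<open>O(n)\<close>.
  The shift \<open>i - 1\<close> is due to vertices being numbered from 1, positions from 0.
\<close>

lemma initial_edges_lower_bound:
  assumes "0 < k"
  shows "(\<Sum>t<n div k. \<Sum>s<t. \<Sum>q<k. \<Sum>p<k. of_bool (letter (phase s) p < letter (phase t) q))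
    \<le> card (initial_edges (colour_graph (\<lambda>i. colour k (i - 1))) n)"
proof -
  \<comment> \<open>The later word \<open>t\<close> and the position \<open>q\<close> in it, the earlier word \<open>s\<close> and the position \<open>p\<close> in it.\<close>
  define P where "P = (SIGMA t:{..<n div k}. SIGMA s:{..<t}. SIGMA q:{..<k}.
    {p. p < k \<and> letter (phase s) p < letter (phase t) q})"
  define f where "f = (\<lambda>(t, s, q, p). {Suc (s * k + p), Suc (t * k + q)})"
  have before: "s * k + p < t * k + q" if "s < t" "p < k" for s t p q
  proof -
    have "s * k + p < Suc s * k" using that by simp
    also have "\<dots> \<le> t * k" using that by (intro mult_le_mono1) simp
    finally show ?thesis by simp
  qed
  have "inj_on f P"
  proof (rule inj_onI)
    fix x x' assume *: "x \<in> P" "x' \<in> P" "f x = f x'"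
    obtain t s q p where x: "x = (t, s, q, p)" by (cases x) auto
    obtain t' s' q' p' where x': "x' = (t', s', q', p')" by (cases x') auto
    have lt: "s < t" "p < k" "q < k" "s' < t'" "p' < k" "q' < k"
      using * by (auto simp: P_def x x')
    have "s * k + p = s' * k + p'" "t * k + q = t' * k + q'"
      using *(3) before[of s t p q] before[of s' t' p' q'] lt
      by (auto simp: f_def x x' doubleton_eq_iff)
    moreover have "a = a' \<and> b = b'" if "a * k + b = a' * k + b'" "b < k" "b' < k" for a b a' b'
    proof -
      have "(a * k + b) div k = a" "(a' * k + b') div k = a'" using that(2,3) by auto
      then have "a = a'" using that(1) by metis
      then show ?thesis using that by auto
    qed
    ultimately show "x = x'" using lt x x' by blast
  qed
  moreover have "f ` P \<subseteq> initial_edges (colour_graph (\<lambda>i. colour k (i - 1))) n"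
  proof
    fix e assume "e \<in> f ` P"
    then obtain t s q p where x: "(t, s, q, p) \<in> P" "e = {Suc (s * k + p), Suc (t * k + q)}"
      by (auto simp: f_def)
    have lt: "s < t" "p < k" "q < k" "t < n div k" "letter (phase s) p < letter (phase t) q"
      using x by (auto simp: P_def)
    have "t * k + q < Suc t * k" using lt by simp
    also have "\<dots> \<le> n div k * k" using lt by (intro mult_le_mono1) simp
    also have "\<dots> \<le> n" by simp
    finally have "t * k + q < n" .
    moreover note before[of s t p q]
    moreover have "colour k (s * k + p) < colour k (t * k + q)"
      using lt by (simp add: colour_def)
    ultimately show "e \<in> initial_edges (colour_graph (\<lambda>i. colour k (i - 1))) n"
      using lt by (auto simp: initial_edges_def x colour_graph_edge_iff)
  qed
  moreover have "finite (initial_edges (colour_graph c) n)" for c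
    by (rule finite_subset[of _ "Pow {1..n}"]) (auto simp: initial_edges_def)
  ultimately have "card P \<le> card (initial_edges (colour_graph (\<lambda>i. colour k (i - 1))) n)"
    by (metis card_image card_mono)
  moreover have "card {p. p < k \<and> R p} = (\<Sum>p<k. of_bool (R p))" for R
    by (simp add: sum.inter_filter[symmetric] of_bool_def flip: card_eq_sum)
  ultimately show ?thesis
    by (simp add: P_def)
qed

text \<open>
  The inequality loses only the diagonal of \<open>area\<close>, which is negative.
\<close>

lemma sum_words:
  assumes "4 \<le> k"
  shows "4 * (\<Sum>t<m. \<Sum>s<t. \<Sum>q<k. \<Sum>p<k. of_bool (letter (phase s) p < letter (phase t) q))
    \<ge> int k * (int k - 1) * (int m * (int m - 1)) + 2 * area m"
proof (induction m)
  case 0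
  show ?case by (simp add: area_def)
next
  case (Suc m)
  have "(\<Sum>s<m. \<Sum>q<k. \<Sum>p<k. of_bool (letter (phase s) p < letter (phase m) q))
    = (\<Sum>s<m. int k * (int k - 1) div 2 + gain (phase s) (phase m))"
    using assms phase_less by (intro sum.cong refl count_words)
  also have "\<dots> = int m * (int k * (int k - 1) div 2) + drift m (phase m)"
    by (simp add: sum.distrib drift_def)
  finally have "4 * (\<Sum>s<m. \<Sum>q<k. \<Sum>p<k. of_bool (letter (phase s) p < letter (phase m) q))
    = 2 * (int m * (2 * (int k * (int k - 1) div 2))) + 4 * drift m (phase m)"
    by simp
  also have "2 * (int k * (int k - 1) div 2) = int k * (int k - 1)"
    by simp
  finally have "4 * (\<Sum>s<m. \<Sum>q<k. \<Sum>p<k. of_bool (letter (phase s) p < letter (phase m) q))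
    = 2 * (int m * (int k * (int k - 1))) + 4 * drift m (phase m)" .
  moreover have "gain (phase m) (phase m) \<le> 0"
    using phase_cases[of m] by (auto simp: gain_table)
  moreover have "int k * (int k - 1) * (int (Suc m) * (int (Suc m) - 1))
    = int k * (int k - 1) * (int m * (int m - 1)) + 2 * (int m * (int k * (int k - 1)))"
    by (simp add: algebra_simps)
  ultimately show ?case
    using Suc.IH by (simp add: area_Suc)
qed

lemma edge_count:
  assumes "4 \<le> k" "18 \<le> n div k"
  defines "m \<equiv> real (n div k)"
  shows "real (card (initial_edges (colour_graph (\<lambda>i. colour k (i - 1))) n))
    \<ge> real k * (real k - 1) / 4 * (m\<^sup>2 - m) + m\<^sup>2 / 2000"
proof -
  define e where "e = card (initial_edges (colour_graph (\<lambda>i. colour k (i - 1))) n)"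
  define d where "d = n div k"
  have "int (\<Sum>t<d. \<Sum>s<t. \<Sum>q<k. \<Sum>p<k. of_bool (letter (phase s) p < letter (phase t) q)) \<le> int e"
    unfolding e_def d_def using assms by (intro of_nat_mono initial_edges_lower_bound) simp
  then have "4 * int e \<ge> int k * (int k - 1) * (int d * (int d - 1)) + 2 * area d"
    using sum_words[OF assms(1), of d] by simp
  moreover have "1000 * area d \<ge> int (d ^ 2)"
    using area_lower_bound[of d] assms by (simp add: d_def)
  ultimately have "2000 * int e \<ge> 500 * (int k * (int k - 1) * (int d * (int d - 1))) + int (d ^ 2)"
    by linarith
  then have "real_of_int (2000 * int e)
    \<ge> real_of_int (500 * (int k * (int k - 1) * (int d * (int d - 1))) + int (d ^ 2))"
    by (simp only: of_int_le_iff)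
  then have "real k * (real k - 1) / 4 * ((real d)\<^sup>2 - real d) + (real d)\<^sup>2 / 2000 \<le> real e"
    by (simp add: field_simps power2_eq_square)
  then show ?thesis
    unfolding m_def d_def e_def .
qed

lemma quadratic_eventually_dominates:
  fixes a m :: real
  assumes "0 \<le> a" "16000 * (a + 1) \<le> m"
  shows "(a + 1 / 4000) * (m + 1)\<^sup>2 \<le> a * (m\<^sup>2 - m) + m\<^sup>2 / 2000"
proof -
  have "16000 * (a + 1) * m \<le> m * m" "1 \<le> m"
    using assms by (auto intro: mult_right_mono)
  moreover have "0 \<le> a * (m - 1)" using calculation assms by simp
  moreover have "(a + 1 / 4000) * (m + 1)\<^sup>2 = a * (m * m) + 2 * (a * m) + a + m * m / 4000 + m / 2000 + 1 / 4000"
    by (simp add: power2_eq_square field_simps)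
  ultimately show ?thesis
    unfolding power2_eq_square by (simp add: distrib_left distrib_right right_diff_distrib mult.assoc)
qed

text \<open>
  Half of the quadratic gain \<open>m\<^sup>2 / 2000\<close> absorbs all linear terms, namely those in \<open>edge_count\<close> and the
  passage from \<open>n\<close> to the number \<open>m\<close> of complete words.
\<close>

lemma path_density_colour_graph:
  assumes "4 \<le> k"
  shows "path_density (colour_graph (\<lambda>i. colour k (i - 1)))
    \<ge> ereal (1 / 4 * (1 - 1 / real k) + 1 / (4000 * (real k)\<^sup>2))"
  unfolding path_density_def
proof (rule Liminf_bounded)
  define a where "a = real k * (real k - 1) / 4"
  define N where "N = k * nat \<lceil>16000 * (a + 1)\<rceil>"
  show "\<forall>\<^sub>F n in sequentially. ereal (1 / 4 * (1 - 1 / real k) + 1 / (4000 * (real k)\<^sup>2))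
    \<le> ereal (real (card (initial_edges (colour_graph (\<lambda>i. colour k (i - 1))) n)) / (real n)\<^sup>2)"
    (is "\<forall>\<^sub>F n in _. _ \<le> ereal (real (?e n) / _)")
    using eventually_ge_at_top[of "N + 1"]
  proof eventually_elim
    case (elim n)
    define m where "m = real (n div k)"
    have a: "0 \<le> a" using assms by (simp add: a_def)
    have "nat \<lceil>16000 * (a + 1)\<rceil> \<le> n div k"
      using elim assms by (simp add: N_def less_eq_div_iff_mult_less_eq mult.commute)
    then have m: "16000 * (a + 1) \<le> m" unfolding m_def by linarith
    then have "18 \<le> n div k" using a by (simp add: m_def)
    have "n < (n div k + 1) * k"
      using dividend_less_div_times[of k n] assms by simp
    then have "real n < (m + 1) * real k"
      unfolding m_def by (metis of_nat_1 of_nat_add of_nat_less_iff of_nat_mult)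
    then have "(real n)\<^sup>2 \<le> ((m + 1) * real k)\<^sup>2"
      by (intro power_mono) auto
    then have "(a + 1 / 4000) / (real k)\<^sup>2 * (real n)\<^sup>2
        \<le> (a + 1 / 4000) / (real k)\<^sup>2 * ((m + 1) * real k)\<^sup>2"
      using a by (intro mult_left_mono) auto
    also have "\<dots> = (a + 1 / 4000) * (m + 1)\<^sup>2"
      using assms by (simp add: power_mult_distrib)
    also have "\<dots> \<le> a * (m\<^sup>2 - m) + m\<^sup>2 / 2000"
      by (rule quadratic_eventually_dominates[OF a m])
    also have "\<dots> \<le> real (?e n)"
      using edge_count[OF assms \<open>18 \<le> n div k\<close>] by (simp add: a_def m_def)
    finally have "(a + 1 / 4000) / (real k)\<^sup>2 \<le> real (?e n) / (real n)\<^sup>2"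
      using elim by (simp add: pos_le_divide_eq)
    moreover have "(a + 1 / 4000) / (real k)\<^sup>2 = 1 / 4 * (1 - 1 / real k) + 1 / (4000 * (real k)\<^sup>2)"
      using assms by (simp add: a_def field_simps power2_eq_square)
    ultimately show ?case by simp
  qed
qed

theorem theorem1p3:
  fixes k :: nat
  assumes "4 \<le> k" and "k \<le> 15"
  shows "path_turan_number k > ereal (1 / 4 * (1 - 1 / real k))"
proof -
  let ?E = "colour_graph (\<lambda>i. colour k (i - 1))"
  have "ereal (1 / 4 * (1 - 1 / real k)) < ereal (1 / 4 * (1 - 1 / real k) + 1 / (4000 * (real k)\<^sup>2))"
    using assms by simp
  also have "\<dots> \<le> path_density ?E"
    using assms by (intro path_density_colour_graph)
  also have "\<dots> \<le> path_turan_number k"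
    unfolding path_turan_number_def
    using assms by (intro SUP_upper) (simp add: simple_colour_graph colour_graph_path_free colour_less)
  finally show ?thesis .
qed

end
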